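(* There is no abstract factorial with three consecutive equal factorials; that is, there are no abstract factorial $!_{a}$ and $k\in\mathbb{N}$ with $k!_{a}=(k+1)!_{a}=(k+2)!_{a}$.
   Context: $\mathbb{N}=\{0,1,2,\dots\}$ and $\mathbb{Z}^+=\{1,2,3,\dots\}$. An abstract factorial is a function $!_{a}:\mathbb{N}\to\mathbb{Z}^+$, $n\mapsto n!_{a}$, such that: (1) $0!_{a}=1$; (2) for all integers $0\le k\le n$, the generalized binomial coefficient $\binom{n}{k}_{a}:=\frac{n!_{a}}{k!_{a}\,(n-k)!_{a}}$ is a positive integer; (3) for every positive integer $n$, the ordinary factorial $n!$ divides $n!_{a}$. The values $n!_{a}$ are called its factorials. *)

theory Defs
  imports Complex_Main
begin

definition gen_binomial :: "(nat \<Rightarrow> nat) \<Rightarrow> nat \<Rightarrow> nat \<Rightarrow> rat" where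
  "gen_binomial f n k = of_nat (f n) / (of_nat (f k) * of_nat (f (n - k)))"

definition abstract_factorial :: "(nat \<Rightarrow> nat) \<Rightarrow> bool" where
  "abstract_factorial f \<longleftrightarrow>
     (\<forall>n. f n > 0) \<and>
     f 0 = 1 \<and>
     (\<forall>n k. k \<le> n \<longrightarrow> gen_binomial f n k \<in> \<int> \<and> gen_binomial f n k > 0) \<and>
     (\<forall>n>0. fact n dvd f n)"

end

theory Submission
  imports Defs
begin

text \<open>Integrality of the generalized binomial coefficients means that
  \<open>f k * f (n - k)\<close> divides \<open>f n\<close>. With n = k + 2 and
  \<open>f (k + 2) = f k\<close>, the product \<open>f k * f 2\<close> divides \<open>f k\<close>,
  which forces \<open>f 2 = 1\<close>; but 2! = 2 divides \<open>f 2\<close>.\<close>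

lemma abstract_factorial_mult_dvd:
  assumes "abstract_factorial f" and "k \<le> n"
  shows "f k * f (n - k) dvd f n"
proof -
  have pos: "f k > 0" "f (n - k) > 0"
    using assms(1) by (auto simp: abstract_factorial_def)
  have "gen_binomial f n k \<in> \<int>"
    using assms by (auto simp: abstract_factorial_def)
  then obtain z where "gen_binomial f n k = of_int z"
    by (auto elim: Ints_cases)
  then have "(of_nat (f n) :: rat) = of_int z * (of_nat (f k) * of_nat (f (n - k)))"
    using pos by (simp add: gen_binomial_def field_simps)
  \<comment> \<open>Both sides become images of integers, so injectivity of \<open>of_int\<close>
    moves the equation from \<open>rat\<close> to \<open>int\<close>.\<close>
  then have "(of_int (int (f n)) :: rat) = of_int (z * int (f k * f (n - k)))"
    by simp
  then have "int (f n) = z * int (f k * f (n - k))"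
    by (simp only: of_int_eq_iff)
  then have "int (f k * f (n - k)) dvd int (f n)"
    by simp
  then show ?thesis
    by (simp only: int_dvd_int_iff)
qed

theorem lemma8:
  shows "\<not> (\<exists>f k. abstract_factorial f \<and> f k = f (k + 1) \<and> f (k + 1) = f (k + 2))"
proof
  assume "\<exists>f k. abstract_factorial f \<and> f k = f (k + 1) \<and> f (k + 1) = f (k + 2)"
  then obtain f k where f: "abstract_factorial f" and eq: "f (k + 2) = f k"
    by metis
  have "f k > 0" and "fact 2 dvd f 2"
    using f unfolding abstract_factorial_def by (blast, metis zero_less_numeral)
  moreover have "f k * f 2 dvd f k"
    using abstract_factorial_mult_dvd[OF f, of k "k + 2"] eq by simp
  \<comment> \<open>Cancelling the positive \<open>f k\<close> leaves \<open>f 2 dvd 1\<close>,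
    while \<open>f 2\<close> is even.\<close>
  ultimately show False
    by (simp add: fact_2)
qed

end
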